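(* Let $\mathtt a$ be a complex parameter, and let $f_1,f_2,f_3,f_4$, the formal row vector $\Psi(z)=(g_1(z)\,g_2(z)\,g_3(z)\,g_4(z))$, the matrix $L$, the row vectors $\Phi_{l+m\pi}(z)$ and the sectors $\Xi_{l+m\pi}$ ($m\in\mathbf Z$) be as defined in the context, where $c_N$ is the normalization constant for which, as $z\to\infty$, $f_k(z)\sim g_k(z)$ on $\Xi(-\frac{\pi}{2},\frac{5\pi}{2})$ for $k=1,2,3$ and $f_4(z)\sim g_4(z)$ on $\Xi(-\frac{3\pi}{2},\frac{3\pi}{2})$. Then for every $m\in\mathbf Z$ the holomorphic solutions $\Phi_{l+m\pi}(z)$ have the asymptotics $$\Phi_{l+m\pi}(z)\sim\Psi(z)\qquad (z\in\Xi_{l+m\pi},\ z\to\infty),$$ and for every $k\in\mathbf Z$ they satisfy the linear relations $$\Phi_{l+(2k+1)\pi}(z)=\Phi_{l+2k\pi}(z)\,L^{k}K_{\overline R}L^{-k}\quad\text{on } \Xi_{l+(2k+1)\pi}\cap\Xi_{l+2k\pi},$$ $$\Phi_{l+(2k+2)\pi}(z)=\Phi_{l+(2k+1)\pi}(z)\,L^{k+1}K_{R}L^{-k-1}\quad\text{on } \Xi_{l+(2k+2)\pi}\cap\Xi_{l+(2k+1)\pi},$$ where $$K_{\overline R}=\begin{pmatrix}1&0&0&-5\\0&1&0&-\frac52+\mathtt a\\0&0&1&-1\\0&0&0&1\end{pmatrix},\qquad K_R=\begin{pmatrix}1&0&0&0\\0&1&0&0\\0&0&1&0\\1&0&0&1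\end{pmatrix}.$$
   Context: All functions are defined on the universal cover of $\mathbf C^*$ (so $\arg z\in\mathbf R$, $z^s=e^{s\log z}$, and $e^{-s\pi i}z$ denotes the point whose argument is decreased by $s\pi$). With $\theta_z=z\frac{d}{dz}$, the differential equation under consideration is $$\{z(\theta_z+1)^3+5(5\theta_z+1)(5\theta_z+2)(5\theta_z+3)(5\theta_z+4)\}\,\hat\Pi(z)=0 .$$ It has a regular singularity at $z=0$ and an irregular one at $z=\infty$. Formal solutions at $z=\infty$. Let $$G(z,\rho)=\sum_{n=0}^\infty\frac{\Gamma(1+5(n+\rho))}{\Gamma(n+\rho+1)^4}\Big(\frac1z\Big)^{n+\rho+1},\qquad \partial_{\tilde\rho}=\frac1{2\pi i}\frac{\partial}{\partial\rho}.$$ Put $g_1=G(z,0)$, $g_2=\partial_{\tilde\rho}G(z,\rho)|_{\rho=0}$, $g_3=\{\frac52\partial_{\tilde\rho}^2+\mathtt a\,\partial_{\tilde\rho}\}G(z,\rho)|_{\rho=0}$, and let $$g_4(z)=\frac{5^5\sqrt5}{2\pi i}e^{-z/5^5}\frac1{z^2}\Big(1-\frac{4375}{z}+\frac{32031250}{z^2}-\cdots\Big)$$ be the formal solution of the equation with this leading factor (the power series in $1/z$ with constant term $1$ is determined by the equation). Set $\Psi(z)=(g_1\,g_2\,g_3\,g_4)$. It satisfies $\Psi(e^{-2\pi i}z)=\Psi(z)L$ with $$L=\begin{pmatrix}1&1&\frac52+\mathtt a&0\\0&1&5&0\\0&0&1&0\\0&0&0&1\end{pmatrix}.$$ Holomorphic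 solutions. Let $\alpha=e^{2\pi i/5}$ and $\alpha^s=e^{2\pi i s/5}$. For $k=1,2,3,4$ and $\rho_k=-\frac k5$ put $$\phi_k(z)=\sum_{n=0}^\infty\frac{\Gamma(1+n+\rho_k)^3\,\Gamma(2+n+\rho_k)}{\Gamma(6+5(n+\rho_k))}(-1)^nz^{n+\rho_k}.$$ For $m=0,\dots,4$ put $$\hat w^\infty_m(z)=(1-\alpha)\sum_{k=1}^4(1-\alpha^k)^3\alpha^{km+\frac12(k-1)}\phi_{5-k}(z).$$ Define $$(f_1\,f_2\,f_3\,f_4)=c_N\,(\hat w^\infty_0\ \hat w^\infty_1\ \hat w^\infty_2\ \hat w^\infty_4)\,N,\qquad N=\begin{pmatrix}1&-\frac25&-\frac{2\mathtt a}5-2&1\\0&\frac25&\frac{2\mathtt a}5-2&-1\\0&\frac15&\frac{\mathtt a}5-\frac12&0\\0&-\frac15&-\frac{\mathtt a}5-\frac12&0\end{pmatrix}.$$ Numerically $c_N=-0.00342934921\ldots$. Sectors and asymptotics. $\Xi(\underline\theta,\bar\theta)=\{z:\underline\theta<\arg z<\bar\theta\}$ and $\Xi_{l+m\pi}=\Xi(-\frac\pi2+m\pi,\frac{3\pi}2+m\pi)$ for $m\in\mathbf Z$. The notation $f\sim g$ on a sector means that the formal series $g$ (including its exponential factor and, for $g_2,g_3$, powers of $\log z$) is the asymptotic expansion, in the sense of Poincaré, of $f$ as $z\to\infty$ in the sector. For row vectors it is understood componentwise. The solutions $\Phi_{l+m\pi}$. With $z_s=e^{-s\pi i}z$ for $s\in\mathbf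 Z$, $$\Phi_{l+m\pi}(z)=\begin{cases}(f_1(z_{m-1})\ f_2(z_{m-1})\ f_3(z_{m-1})\ f_4(e^{-2\pi i}z_{m-1}))\,L^{-\frac{m-1}2}& m\text{ odd},\\ (f_1(z_m)\ f_2(z_m)\ f_3(z_m)\ f_4(z_m))\,L^{-\frac m2}& m\text{ even}.\end{cases}$$ *)

theory Defs
  imports "HOL-Complex_Analysis.Complex_Analysis"
    "HOL-Computational_Algebra.Formal_Laurent_Series"
begin

text \<open>
  A point \<open>z\<close> of the universal cover of the punctured complex plane is represented by its
  logarithm \<open>t = log z\<close>, which is a global holomorphic coordinate. Hence \<open>z = exp t\<close>,
  \<open>arg z = Im t\<close>, \<open>|z| = exp (Re t)\<close>, a function is holomorphic on the cover iff it is entire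
  in \<open>t\<close>, and \<open>z d/dz\<close> is \<open>d/dt\<close>.
\<close>

type_synonym cover = complex

definition zpow :: "cover \<Rightarrow> complex \<Rightarrow> complex" where
  "zpow t s = exp (s * t)"

text \<open>\<open>rot s z\<close> is the point \<open>z\<^sub>s = e\<^bsup>-s\<pi>i\<^esup> z\<close>.\<close>

definition rot :: "int \<Rightarrow> cover \<Rightarrow> cover" where
  "rot s t = t - of_int s * of_real pi * \<i>"

definition Xi :: "real \<Rightarrow> real \<Rightarrow> cover set" where
  "Xi lo hi = {t. lo < Im t \<and> Im t < hi}"

definition Xi_l :: "int \<Rightarrow> cover set" where
  "Xi_l m = Xi (- (pi / 2) + of_int m * pi) (3 * pi / 2 + of_int m * pi)"

definition hol_solution :: "(cover \<Rightarrow> complex) \<Rightarrow> bool" where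
  "hol_solution f \<longleftrightarrow> f holomorphic_on UNIV \<and>
     (let lin = (\<lambda>p q h t. p * deriv h t + q * h t)
      in \<forall>t. exp t * (lin 1 1 ^^ 3) f t
             + 5 * lin 5 1 (lin 5 2 (lin 5 3 (lin 5 4 f))) t = 0)"


subsection \<open>Formal series and asymptotic expansions\<close>

text \<open>
  \<open>Formal c r T\<close> stands for the formal expression \<open>exp (c z) (T 0 z + T 1 z + \<dots>)\<close>, where \<open>T n z\<close> is
  \<open>z\<^bsup>-(r+n)\<^esup>\<close> times a polynomial in \<open>log z\<close>.
\<close>

datatype formal_series =
  Formal (exp_rate: complex) (lead_order: nat) (series_term: "nat \<Rightarrow> cover \<Rightarrow> complex")

definition at_inf_arg :: "real \<Rightarrow> real \<Rightarrow> cover filter" where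
  "at_inf_arg lo hi =
     inf (filtercomap (\<lambda>t. norm (exp t)) at_top) (principal {t. lo \<le> Im t \<and> Im t \<le> hi})"

text \<open>
  Poincare asymptotics on a sector. As usual, the estimates are uniform on every closed subsector
  and not on the open sector itself, where they fail in general. The remainder after the term of
  order \<open>z\<^bsup>-(r+n)\<^esup>\<close> is required to be \<open>o(z\<^bsup>-(r+n)\<^esup>)\<close>, relative to the exponential factor; this
  scale also accommodates terms with powers of \<open>log z\<close>.
\<close>

definition poincare_asymp :: "cover set \<Rightarrow> (cover \<Rightarrow> complex) \<Rightarrow> formal_series \<Rightarrow> bool" where
  "poincare_asymp S f g \<longleftrightarrow>
     (\<forall>lo hi. lo \<le> hi \<and> {t. lo \<le> Im t \<and> Im t \<le> hi} \<subseteq> S \<longrightarrow>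
       (\<forall>n. ((\<lambda>t. zpow t (of_nat (lead_order g + n)) *
                   (exp (- exp_rate g * exp t) * f t - (\<Sum>j\<le>n. series_term g j t)))
              \<longlongrightarrow> 0) (at_inf_arg lo hi)))"


subsection \<open>The formal solutions at infinity\<close>

definition G_term :: "nat \<Rightarrow> cover \<Rightarrow> complex \<Rightarrow> complex" where
  "G_term n t \<rho> = Gamma (1 + 5 * (of_nat n + \<rho>)) / Gamma (of_nat n + \<rho> + 1) ^ 4
                   * zpow t (- (of_nat n + \<rho> + 1))"

definition d_rho :: "(complex \<Rightarrow> complex) \<Rightarrow> complex \<Rightarrow> complex" where
  "d_rho h \<rho> = deriv h \<rho> / (2 * of_real pi * \<i>)"

definition g1 :: formal_series where
  "g1 = Formal 0 1 (\<lambda>n t. G_term n t 0)"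

definition g2 :: formal_series where
  "g2 = Formal 0 1 (\<lambda>n t. d_rho (G_term n t) 0)"

definition g3 :: "complex \<Rightarrow> formal_series" where
  "g3 a = Formal 0 1 (\<lambda>n t. 5 / 2 * d_rho (d_rho (G_term n t)) 0 + a * d_rho (G_term n t) 0)"

text \<open>
  A formal Laurent series \<open>F\<close> in \<open>1/z\<close> (so that \<open>fls_X\<close> is \<open>1/z\<close>) represents \<open>e\<^bsup>cz\<^esup> F\<close>, and
  \<open>theta_exp c F\<close> represents \<open>z d/dz\<close> of it, namely \<open>e\<^bsup>cz\<^esup> (c z F + z F')\<close>; in terms of
  \<open>w = 1/z\<close> one has \<open>z d/dz = - w d/dw\<close>.
\<close>

definition theta_exp :: "complex \<Rightarrow> complex fls \<Rightarrow> complex fls" where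
  "theta_exp c F = fls_const c * fls_X_inv * F - fls_X * fls_deriv F"

definition formal_solution :: "complex \<Rightarrow> complex fls \<Rightarrow> bool" where
  "formal_solution c F \<longleftrightarrow>
     (let lin = (\<lambda>p q H. p * theta_exp c H + q * H)
      in fls_X_inv * (lin 1 1 ^^ 3) F
         + 5 * lin 5 1 (lin 5 2 (lin 5 3 (lin 5 4 F))) = 0)"

text \<open>
  The equation determines this series:
  \<open>1 - 4375/z + 32031250/z\<^sup>2 - 331933593750/z\<^sup>3 + \<dots>\<close>.
\<close>

definition g4_series :: "complex fps" where
  "g4_series = (THE P. fps_nth P 0 = 1 \<and> formal_solution (- 1 / 5 ^ 5) (fls_X ^ 2 * fps_to_fls P))"

definition g4 :: formal_series where
  "g4 = Formal (- 1 / 5 ^ 5) 2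
     (\<lambda>n t. 5 ^ 5 * of_real (sqrt 5) / (2 * of_real pi * \<i>)
             * fps_nth g4_series n * zpow t (- of_nat (2 + n)))"

definition Psi :: "complex \<Rightarrow> formal_series ^ 4" where
  "Psi a = (\<chi> k. if k = 1 then g1 else if k = 2 then g2 else if k = 3 then g3 a else g4)"


subsection \<open>The matrices\<close>

definition L_mat :: "complex \<Rightarrow> complex ^ 4 ^ 4" where
  "L_mat a = vector
     [vector [1, 1, 5 / 2 + a, 0],
      vector [0, 1, 5, 0],
      vector [0, 0, 1, 0],
      vector [0, 0, 0, 1]]"

definition N_mat :: "complex \<Rightarrow> complex ^ 4 ^ 4" where
  "N_mat a = vector
     [vector [1, - 2 / 5, - (2 * a / 5) - 2, 1],
      vector [0, 2 / 5, 2 * a / 5 - 2, - 1],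
      vector [0, 1 / 5, a / 5 - 1 / 2, 0],
      vector [0, - 1 / 5, - (a / 5) - 1 / 2, 0]]"

definition K_Rbar :: "complex \<Rightarrow> complex ^ 4 ^ 4" where
  "K_Rbar a = vector
     [vector [1, 0, 0, - 5],
      vector [0, 1, 0, - 5 / 2 + a],
      vector [0, 0, 1, - 1],
      vector [0, 0, 0, 1]]"

definition K_R :: "complex ^ 4 ^ 4" where
  "K_R = vector
     [vector [1, 0, 0, 0],
      vector [0, 1, 0, 0],
      vector [0, 0, 1, 0],
      vector [1, 0, 0, 1]]"

text \<open>Integer powers of a matrix (\<open>(^)\<close> on vectors is componentwise).\<close>

definition mat_powi :: "'a::comm_ring_1 ^ 'n ^ 'n \<Rightarrow> int \<Rightarrow> 'a ^ 'n ^ 'n" where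
  "mat_powi A k = (if k \<ge> 0 then (((**) A) ^^ nat k) (mat 1)
                   else (((**) (matrix_inv A)) ^^ nat (- k)) (mat 1))"


subsection \<open>The holomorphic solutions\<close>

definition alpha_pow :: "complex \<Rightarrow> complex" where
  "alpha_pow s = exp (2 * of_real pi * \<i> * s / 5)"

definition rho_k :: "nat \<Rightarrow> complex" where
  "rho_k k = - of_nat k / 5"

definition phi :: "nat \<Rightarrow> cover \<Rightarrow> complex" where
  "phi k t = (\<Sum>n. Gamma (1 + of_nat n + rho_k k) ^ 3 * Gamma (2 + of_nat n + rho_k k)
                    / Gamma (6 + 5 * (of_nat n + rho_k k))
                    * (- 1) ^ n * zpow t (of_nat n + rho_k k))"

definition w_inf :: "nat \<Rightarrow> cover \<Rightarrow> complex" where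
  "w_inf m t = (1 - alpha_pow 1) *
     (\<Sum>k=1..4. (1 - alpha_pow (of_nat k)) ^ 3
                 * alpha_pow (of_nat (k * m) + (of_nat k - 1) / 2) * phi (5 - k) t)"

definition f_row :: "complex \<Rightarrow> complex \<Rightarrow> cover \<Rightarrow> complex ^ 4" where
  "f_row a c t = c *s (vector [w_inf 0 t, w_inf 1 t, w_inf 2 t, w_inf 4 t] v* N_mat a)"

definition Phi :: "complex \<Rightarrow> complex \<Rightarrow> int \<Rightarrow> cover \<Rightarrow> complex ^ 4" where
  "Phi a c m t =
     (if odd m then
        vector [f_row a c (rot (m - 1) t) $ 1, f_row a c (rot (m - 1) t) $ 2,
                f_row a c (rot (m - 1) t) $ 3, f_row a c (rot 2 (rot (m - 1) t)) $ 4]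
        v* mat_powi (L_mat a) (- ((m - 1) div 2))
      else f_row a c (rot m t) v* mat_powi (L_mat a) (- (m div 2)))"

end

theory Submission
  imports Defs
begin

text \<open>
  Everything is governed by the full turn \<open>z \<mapsto> z\<^sub>2 = e\<^bsup>-2\<pi>i\<^esup> z\<close>, whose action is explicit both on the
  formal solutions at infinity and on the convergent series at zero.

  On the formal side each coefficient of \<open>G(z, \<rho>)\<close> is multiplied by \<open>e\<^bsup>2\<pi>i\<rho>\<^esup>\<close>, so that
  \<open>\<partial>\<^sub>\<rho> / 2\<pi>i\<close> turns into \<open>\<partial>\<^sub>\<rho> / 2\<pi>i + 1\<close>. At \<open>\<rho> = 0\<close> this is \<open>\<Psi>(z\<^sub>2) = \<Psi>(z) L\<close>. Rotating the given
  asymptotics by \<open>j\<close> turns therefore yields \<open>f(z\<^sub>2\<^sub>j) \<sim> \<Psi>(z) L\<^sup>j\<close> on the rotated sectors, and the factor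
  \<open>L\<^sup>-\<^sup>j\<close> in \<open>\<Phi>\<close> restores \<open>\<Psi>\<close> (\<open>poincare_asymp_rot\<close>, \<open>poincare_asymp_L_pow_row\<close>).
  The given sectors have opening \<open>3\<pi>\<close>, and the sector \<open>\<Xi>\<^sub>l\<close>, of opening \<open>2\<pi>\<close>, is their intersection.
  Moved on by \<open>\<pi>\<close> it stays within the sector of \<open>f\<^sub>1, f\<^sub>2, f\<^sub>3\<close> but leaves that of \<open>f\<^sub>4\<close>; one more
  turn of \<open>f\<^sub>4\<close> alone, which does not change the formal series \<open>g\<^sub>4\<close>, makes up for this.

  On the convergent side the turn permutes the five functions \<open>w\<^sub>0, \<dots>, w\<^sub>4\<close> cyclically
  (\<open>w_inf_rot\<close>), and their sum vanishes (\<open>sum_w_inf\<close>). Hence it acts on the row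
  \<open>(w\<^sub>0 w\<^sub>1 w\<^sub>2 w\<^sub>4)\<close> by an integer matrix, and both linear relations reduce to identities between
  \<open>4 \<times> 4\<close> matrices, which hold on the whole cover and not only on the overlaps of sectors
  (\<open>half_rotated_row_eq\<close>, \<open>f_row_rot_eq\<close>).

  That the \<open>\<Phi>\<close> solve the differential equation comes down to the \<open>\<phi>\<^sub>k\<close>: these are Frobenius series
  at zero whose exponents are the roots of the indicial polynomial, whose Gamma quotients satisfy the
  recurrence required by the equation, and which converge everywhere because zero is the only
  finite singularity.
\<close>
section \<open>Rows and matrices of size four\<close>

lemma vector_4 [simp]:
  "(vector [x, y, z, w] :: 'a::zero ^ 4) $ 1 = x"
  "(vector [x, y, z, w] :: 'a::zero ^ 4) $ 2 = y"
  "(vector [x, y, z, w] :: 'a::zero ^ 4) $ 3 = z"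
  "(vector [x, y, z, w] :: 'a::zero ^ 4) $ 4 = w"
  unfolding vector_def by simp_all

lemmas mat4_simps =
  vec_eq_iff forall_4 sum_4 matrix_matrix_mult_def vector_matrix_mult_def mat_def

lemma matrix_inv_eqI:
  fixes A B :: "'a::comm_ring_1 ^ 'n ^ 'n"
  assumes "A ** B = mat 1" and "B ** A = mat 1"
  shows "matrix_inv A = B"
proof -
  have "A ** matrix_inv A = mat 1 \<and> matrix_inv A ** A = mat 1"
    unfolding matrix_inv_def by (rule someI[of _ B]) (use assms in simp)
  then show ?thesis
    using assms(2) by (metis matrix_mul_assoc matrix_mul_lid matrix_mul_rid)
qed

section \<open>The one-parameter group through the formal monodromy\<close>

text \<open>
  The matrix \<open>L\<^sup>s = exp (s log L)\<close>. As \<open>L\<close> is unipotent, the entries are polynomials in \<open>s\<close>, and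
  the quadratic one comes from the two steps in its Jordan chain.
\<close>
definition L_pow :: "complex \<Rightarrow> complex \<Rightarrow> complex ^ 4 ^ 4" where
  "L_pow a s = vector
     [vector [1, s, 5 / 2 * s\<^sup>2 + a * s, 0],
      vector [0, 1, 5 * s, 0],
      vector [0, 0, 1, 0],
      vector [0, 0, 0, 1]]"

lemma L_pow_add: "L_pow a s ** L_pow a t = L_pow a (s + t)"
  by (simp add: mat4_simps L_pow_def algebra_simps power2_eq_square)

lemma L_pow_0: "L_pow a 0 = mat 1"
  by (simp add: mat4_simps L_pow_def)

lemma L_mat_eq_L_pow: "L_mat a = L_pow a 1"
  by (simp add: mat4_simps L_pow_def L_mat_def)

lemma matrix_inv_L_mat: "matrix_inv (L_mat a) = L_pow a (- 1)"
  by (rule matrix_inv_eqI) (simp_all add: L_mat_eq_L_pow L_pow_add L_pow_0)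

lemma funpow_L_pow: "(((**) (L_pow a s)) ^^ n) (mat 1) = L_pow a (of_nat n * s)"
  by (induction n) (simp_all add: L_pow_0 L_pow_add algebra_simps)

lemma mat_powi_L_mat: "mat_powi (L_mat a) k = L_pow a (of_int k)"
proof (cases "k \<ge> 0")
  case True
  then show ?thesis
    by (simp add: mat_powi_def L_mat_eq_L_pow funpow_L_pow)
next
  case False
  then show ?thesis
    by (simp add: mat_powi_def matrix_inv_L_mat funpow_L_pow)
qed

section \<open>Rotations of the universal cover\<close>

lemma rot_rot: "rot i (rot j t) = rot (i + j) t"
  by (simp add: rot_def algebra_simps)

lemma exp_even_rot: "exp (rot (2 * j) t) = exp t"
proof -
  have "exp (of_int (2 * j) * of_real pi * \<i>) = 1"
    using exp_integer_2pi[of "of_int j"] by simp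
  then show ?thesis
    by (simp add: rot_def exp_diff)
qed

section \<open>Convergent power solutions of the equation\<close>

text \<open>The factor \<open>p \<theta> + q\<close> of the differential operator, in the coordinate \<open>t = log z\<close>.\<close>
definition first_order :: "complex \<Rightarrow> complex \<Rightarrow> (complex \<Rightarrow> complex) \<Rightarrow> complex \<Rightarrow> complex" where
  "first_order p q h t = p * deriv h t + q * h t"

definition quintic_op :: "(complex \<Rightarrow> complex) \<Rightarrow> complex \<Rightarrow> complex" where
  "quintic_op f t = exp t * first_order 1 1 (first_order 1 1 (first_order 1 1 f)) t
     + 5 * first_order 5 1 (first_order 5 2 (first_order 5 3 (first_order 5 4 f))) t"

lemma hol_solution_iff:
  "hol_solution f \<longleftrightarrow> f holomorphic_on UNIV \<and> (\<forall>t. quintic_op f t = 0)"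
  by (simp add: hol_solution_def quintic_op_def first_order_def[abs_def] Let_def eval_nat_numeral)

lemma holomorphic_first_order [holomorphic_intros]:
  "f holomorphic_on UNIV \<Longrightarrow> first_order p q f holomorphic_on UNIV"
  unfolding first_order_def[abs_def] by (intro holomorphic_intros) auto

lemma first_order_linear:
  assumes "f holomorphic_on UNIV" "g holomorphic_on UNIV"
  shows "first_order p q (\<lambda>t. x * f t + y * g t)
       = (\<lambda>t. x * first_order p q f t + y * first_order p q g t)"
proof
  fix t
  have "f field_differentiable at t" "g field_differentiable at t"
    using assms by (auto simp: holomorphic_on_def)
  then show "first_order p q (\<lambda>t. x * f t + y * g t) t
      = x * first_order p q f t + y * first_order p q g t"
    by (simp add: first_order_def algebra_simps field_differentiable_mult)
qed

lemma hol_solution_linear: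
  assumes "hol_solution f" "hol_solution g"
  shows "hol_solution (\<lambda>t. x * f t + y * g t)"
proof -
  have h [holomorphic_intros]: "f holomorphic_on UNIV" "g holomorphic_on UNIV"
    and z: "quintic_op f t = 0" "quintic_op g t = 0" for t
    using assms by (auto simp: hol_solution_iff)
  have "quintic_op (\<lambda>t. x * f t + y * g t) t = x * quintic_op f t + y * quintic_op g t" for t
    by (simp add: quintic_op_def first_order_linear holomorphic_first_order h algebra_simps)
  then show ?thesis
    by (auto simp: hol_solution_iff z intro!: holomorphic_intros)
qed

lemma hol_solution_mult: "hol_solution f \<Longrightarrow> hol_solution (\<lambda>t. x * f t)"
  using hol_solution_linear[of f f x 0] by simp

lemma hol_solution_add: "hol_solution f \<Longrightarrow> hol_solution g \<Longrightarrow> hol_solution (\<lambda>t. f t + g t)"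
  using hol_solution_linear[of f g 1 1] by simp

lemma hol_solution_0: "hol_solution (\<lambda>t. 0)"
  by (simp add: hol_solution_iff quintic_op_def first_order_def[abs_def])

lemma hol_solution_sum:
  "(\<And>i. i \<in> A \<Longrightarrow> hol_solution (f i)) \<Longrightarrow> hol_solution (\<lambda>t. \<Sum>i\<in>A. f i t)"
  by (induction A rule: infinite_finite_induct) (simp_all add: hol_solution_0 hol_solution_add)

lemma first_order_rot:
  assumes "f holomorphic_on UNIV"
  shows "first_order p q (f \<circ> rot j) = first_order p q f \<circ> rot j"
proof
  fix t
  have "(f has_field_derivative deriv f (rot j t)) (at (rot j t))"
    using assms by (simp add: holomorphic_derivI)
  moreover have "(rot j has_field_derivative 1) (at t)"
    unfolding rot_def by (auto intro!: derivative_eq_intros)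
  ultimately have "(f \<circ> rot j has_field_derivative deriv f (rot j t)) (at t)"
    by (metis DERIV_chain mult_1_right)
  then show "first_order p q (f \<circ> rot j) t = (first_order p q f \<circ> rot j) t"
    by (simp add: first_order_def DERIV_imp_deriv)
qed

text \<open>
  The only coefficient of the equation which is not constant in \<open>t\<close> is \<open>exp t\<close>, and this is the same
  on all sheets of the cover.
\<close>
lemma hol_solution_rot:
  assumes "hol_solution f"
  shows "hol_solution (\<lambda>t. f (rot (2 * j) t))"
proof -
  have h: "f holomorphic_on UNIV" and z: "quintic_op f t = 0" for t
    using assms by (auto simp: hol_solution_iff)
  have "quintic_op (f \<circ> rot (2 * j)) t = quintic_op f (rot (2 * j) t)" for t
    by (simp add: quintic_op_def first_order_rot holomorphic_first_order h exp_even_rot)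
  moreover have "rot (2 * j) holomorphic_on UNIV"
    unfolding rot_def by (intro holomorphic_intros)
  then have "f \<circ> rot (2 * j) holomorphic_on UNIV"
    using h by (rule holomorphic_on_compose_gen) auto
  ultimately show ?thesis
    by (simp add: hol_solution_iff z o_def)
qed

definition entire_coeffs :: "(nat \<Rightarrow> complex) \<Rightarrow> bool" where
  "entire_coeffs c \<longleftrightarrow> (\<forall>z. summable (\<lambda>n. c n * z ^ n))"

text \<open>A Frobenius series \<open>z\<^bsup>\<rho>\<^esup> (c\<^sub>0 + c\<^sub>1 z + \<dots>)\<close>.\<close>
definition pow_series :: "(nat \<Rightarrow> complex) \<Rightarrow> complex \<Rightarrow> cover \<Rightarrow> complex" where
  "pow_series c \<rho> t = (\<Sum>n. c n * zpow t (of_nat n + \<rho>))"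

lemma zpow_of_nat_add: "zpow t (of_nat n + \<rho>) = exp t ^ n * zpow t \<rho>"
  by (simp add: zpow_def ring_distribs exp_add flip: exp_of_nat_mult)

lemma summable_pow_series:
  assumes "entire_coeffs c"
  shows "summable (\<lambda>n. c n * zpow t (of_nat n + \<rho>))"
  using summable_mult2[of "\<lambda>n. c n * exp t ^ n" "zpow t \<rho>"] assms
  by (simp add: entire_coeffs_def zpow_of_nat_add mult_ac)

text \<open>
  The coefficients \<open>n c\<^sub>n\<close> are those of \<open>z F'(z)\<close> if the \<open>c\<^sub>n\<close> are those of \<open>F\<close>, and an entire
  function has an entire derivative.
\<close>
lemma entire_coeffs_of_nat_mult:
  assumes "entire_coeffs c"
  shows "entire_coeffs (\<lambda>n. of_nat n * c n)"
    and "(\<Sum>n. of_nat n * c n * z ^ n) = z * (\<Sum>n. diffs c n * z ^ n)"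
proof -
  have *: "(\<lambda>n. of_nat n * c n * z ^ n) sums (z * (\<Sum>n. diffs c n * z ^ n))" for z
  proof -
    have "summable (\<lambda>n. diffs c n * z ^ n)"
      using assms by (intro termdiff_converges_all) (simp add: entire_coeffs_def)
    then have "(\<lambda>n. z * (of_nat n * c n * z ^ (n - Suc 0))) sums (z * (\<Sum>n. diffs c n * z ^ n))"
      by (intro sums_mult diffs_equiv)
    moreover have "z * (of_nat n * c n * z ^ (n - Suc 0)) = of_nat n * c n * z ^ n" for n
      by (cases n) simp_all
    ultimately show ?thesis by simp
  qed
  show "entire_coeffs (\<lambda>n. of_nat n * c n)"
    using * by (auto simp: entire_coeffs_def sums_iff)
  show "(\<Sum>n. of_nat n * c n * z ^ n) = z * (\<Sum>n. diffs c n * z ^ n)"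
    using *[of z] by (simp add: sums_iff)
qed

lemma entire_coeffs_linear:
  assumes "entire_coeffs c" "entire_coeffs d"
  shows "entire_coeffs (\<lambda>n. x * c n + y * d n)"
  using assms unfolding entire_coeffs_def
  by (auto simp: ring_distribs mult.assoc intro!: summable_add summable_mult)

lemma entire_coeffs_first_order:
  assumes "entire_coeffs c"
  shows "entire_coeffs (\<lambda>n. (p * (of_nat n + \<rho>) + q) * c n)"
  using entire_coeffs_linear[OF entire_coeffs_of_nat_mult(1)[OF assms] assms, of p "p * \<rho> + q"]
  by (simp add: algebra_simps)

lemma pow_series_eq:
  assumes "entire_coeffs c"
  shows "pow_series c \<rho> t = (\<Sum>n. c n * exp t ^ n) * zpow t \<rho>"
  using assms unfolding pow_series_def entire_coeffs_def zpow_of_nat_add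
  by (subst suminf_mult2) (simp_all add: mult_ac)

lemma has_field_derivative_pow_series:
  assumes "entire_coeffs c"
  shows "(pow_series c \<rho> has_field_derivative
           pow_series (\<lambda>n. (of_nat n + \<rho>) * c n) \<rho> t) (at t)"
proof -
  define F where "F z = (\<Sum>n. c n * z ^ n)" for z
  have F: "(F has_field_derivative (\<Sum>n. diffs c n * z ^ n)) (at z)" for z
    unfolding F_def using assms
    by (intro termdiffs_strong_converges_everywhere) (simp add: entire_coeffs_def)
  have eq: "pow_series c \<rho> = (\<lambda>t. F (exp t) * zpow t \<rho>)"
    using pow_series_eq[OF assms] by (auto simp: F_def)
  have "((\<lambda>t. F (exp t)) has_field_derivative (\<Sum>n. diffs c n * exp t ^ n) * exp t) (at t)"
    by (rule DERIV_chain2[OF F DERIV_exp])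
  moreover have "((\<lambda>t. zpow t \<rho>) has_field_derivative \<rho> * zpow t \<rho>) (at t)"
    unfolding zpow_def by (auto intro!: derivative_eq_intros)
  ultimately have D: "(pow_series c \<rho> has_field_derivative
      (\<Sum>n. diffs c n * exp t ^ n) * exp t * zpow t \<rho> + \<rho> * zpow t \<rho> * F (exp t)) (at t)"
    unfolding eq by (rule DERIV_mult)
  have sm: "summable (\<lambda>n. of_nat n * c n * exp t ^ n)" "summable (\<lambda>n. c n * exp t ^ n)"
    using assms entire_coeffs_of_nat_mult(1)[OF assms] by (simp_all add: entire_coeffs_def)
  have "pow_series (\<lambda>n. (of_nat n + \<rho>) * c n) \<rho> t
      = (\<Sum>n. of_nat n * c n * exp t ^ n + \<rho> * (c n * exp t ^ n)) * zpow t \<rho>"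
    using entire_coeffs_first_order[OF assms, of 1 \<rho> 0]
    by (simp add: pow_series_eq algebra_simps)
  also have "(\<Sum>n. of_nat n * c n * exp t ^ n + \<rho> * (c n * exp t ^ n))
      = exp t * (\<Sum>n. diffs c n * exp t ^ n) + \<rho> * F (exp t)"
    using sm by (simp add: suminf_add[symmetric] suminf_mult F_def
        entire_coeffs_of_nat_mult(2)[OF assms] summable_mult)
  finally have "pow_series (\<lambda>n. (of_nat n + \<rho>) * c n) \<rho> t
     = (\<Sum>n. diffs c n * exp t ^ n) * exp t * zpow t \<rho> + \<rho> * zpow t \<rho> * F (exp t)"
    by (simp add: algebra_simps)
  with D show ?thesis by simp
qed

lemma holomorphic_pow_series: "entire_coeffs c \<Longrightarrow> pow_series c \<rho> holomorphic_on UNIV"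
  using has_field_derivative_pow_series
  by (auto simp: holomorphic_on_def field_differentiable_def)

text \<open>The powers \<open>z\<^sup>s\<close> are eigenfunctions of \<open>\<theta>\<close>, with eigenvalue \<open>s\<close>.\<close>
lemma first_order_pow_series:
  assumes "entire_coeffs c"
  shows "first_order p q (pow_series c \<rho>) = pow_series (\<lambda>n. (p * (of_nat n + \<rho>) + q) * c n) \<rho>"
proof
  fix t
  have sm: "summable (\<lambda>n. (of_nat n + \<rho>) * c n * zpow t (of_nat n + \<rho>))"
    using entire_coeffs_first_order[OF assms, of 1 \<rho> 0]
    by (intro summable_pow_series) simp
  have "deriv (pow_series c \<rho>) t = pow_series (\<lambda>n. (of_nat n + \<rho>) * c n) \<rho> t"
    using assms by (intro DERIV_imp_deriv has_field_derivative_pow_series)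
  then have "first_order p q (pow_series c \<rho>) t
      = (\<Sum>n. p * ((of_nat n + \<rho>) * c n * zpow t (of_nat n + \<rho>)))
      + (\<Sum>n. q * (c n * zpow t (of_nat n + \<rho>)))"
    using sm summable_pow_series[OF assms]
    by (simp add: first_order_def pow_series_def suminf_mult)
  also have "\<dots> = pow_series (\<lambda>n. (p * (of_nat n + \<rho>) + q) * c n) \<rho> t"
    unfolding pow_series_def using sm summable_pow_series[OF assms]
    by (subst suminf_add[OF summable_mult summable_mult]) (simp_all add: algebra_simps)
  finally show "first_order p q (pow_series c \<rho>) t
      = pow_series (\<lambda>n. (p * (of_nat n + \<rho>) + q) * c n) \<rho> t" .
qed

text \<open>
  The eigenvalue on \<open>z\<^sup>s\<close> of the part \<open>5 (5\<theta> + 1) (5\<theta> + 2) (5\<theta> + 3) (5\<theta> + 4)\<close> of the operator that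
  preserves exponents.
\<close>
definition indicial :: "complex \<Rightarrow> complex" where
  "indicial s = 5 * (5 * s + 1) * (5 * s + 2) * (5 * s + 3) * (5 * s + 4)"

text \<open>
  The other part \<open>z (\<theta> + 1)\<^sup>3\<close> of the operator raises the exponent by one, so the equation is a
  two-term recurrence for the coefficients. The power \<open>z\<^bsup>\<rho>\<^esup>\<close> itself arises from the first part only,
  whence the indicial equation.
\<close>
lemma hol_solution_pow_series:
  assumes c: "entire_coeffs c"
    and indicial: "indicial \<rho> = 0"
    and recurrence: "\<And>n. indicial (of_nat (Suc n) + \<rho>) * c (Suc n)
                       = - ((of_nat (Suc n) + \<rho>) ^ 3 * c n)"
  shows "hol_solution (pow_series c \<rho>)"
proof -
  define d where "d n = (of_nat (Suc n) + \<rho>) ^ 3 * c n" for n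
  define e where "e n = indicial (of_nat n + \<rho>) * c n" for n
  have c3: "entire_coeffs (\<lambda>n. (1 * (of_nat n + \<rho>) + 1) * ((1 * (of_nat n + \<rho>) + 1) *
      ((1 * (of_nat n + \<rho>) + 1) * c n)))"
    by (intro entire_coeffs_first_order c)
  have deq: "(\<lambda>n. (1 * (of_nat n + \<rho>) + 1) * ((1 * (of_nat n + \<rho>) + 1) *
      ((1 * (of_nat n + \<rho>) + 1) * c n))) = d"
    by (auto simp: d_def power3_eq_cube algebra_simps)
  have five: "entire_coeffs (\<lambda>n. 5 * b n)" if "entire_coeffs b" for b
    using entire_coeffs_linear[OF that that, of 5 0] by simp
  have c4: "entire_coeffs (\<lambda>n. 5 * ((5 * (of_nat n + \<rho>) + 1) * ((5 * (of_nat n + \<rho>) + 2) *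
      ((5 * (of_nat n + \<rho>) + 3) * ((5 * (of_nat n + \<rho>) + 4) * c n)))))"
    by (intro five entire_coeffs_first_order c)
  have eeq: "(\<lambda>n. 5 * ((5 * (of_nat n + \<rho>) + 1) * ((5 * (of_nat n + \<rho>) + 2) *
      ((5 * (of_nat n + \<rho>) + 3) * ((5 * (of_nat n + \<rho>) + 4) * c n))))) = e"
    by (auto simp: e_def indicial_def mult_ac)
  have d: "entire_coeffs d" and e: "entire_coeffs e"
    using c3 c4 unfolding deq eeq .
  have "quintic_op (pow_series c \<rho>) t = 0" for t
  proof -
    have "quintic_op (pow_series c \<rho>) t = exp t * pow_series d \<rho> t + pow_series e \<rho> t"
    proof -
      have "5 * pow_series b \<rho> t = pow_series (\<lambda>n. 5 * b n) \<rho> t" if "entire_coeffs b" for b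
        unfolding pow_series_def using summable_pow_series[OF that]
        by (subst suminf_mult[symmetric]) (simp_all add: mult_ac)
      then show ?thesis
        unfolding quintic_op_def deq[symmetric] eeq[symmetric]
        by (simp only: first_order_pow_series entire_coeffs_first_order c)
    qed
    also have "pow_series e \<rho> t = (\<Sum>n. e (Suc n) * zpow t (of_nat (Suc n) + \<rho>))"
      unfolding pow_series_def
      using suminf_split_head[OF summable_pow_series[OF e, of t \<rho>]] indicial
      by (simp add: e_def)
    also have "\<dots> = (\<Sum>n. - (exp t * (d n * zpow t (of_nat n + \<rho>))))"
      unfolding e_def recurrence d_def zpow_of_nat_add
      by (simp only: power_Suc mult_ac mult_minus_left mult_minus_right)
    also have "\<dots> = - (exp t * pow_series d \<rho> t)"
      unfolding pow_series_def using summable_pow_series[OF d]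
      by (simp add: suminf_minus suminf_mult summable_mult)
    finally show ?thesis by simp
  qed
  then show ?thesis
    using holomorphic_pow_series[OF c] by (simp add: hol_solution_iff)
qed

definition phi_coeff :: "nat \<Rightarrow> nat \<Rightarrow> complex" where
  "phi_coeff k n = Gamma (1 + of_nat n + rho_k k) ^ 3 * Gamma (2 + of_nat n + rho_k k)
                    / Gamma (6 + 5 * (of_nat n + rho_k k)) * (- 1) ^ n"

lemma phi_eq: "phi k = pow_series (phi_coeff k) (rho_k k)"
  by (simp add: phi_def pow_series_def phi_coeff_def fun_eq_iff)

lemma Gamma_plus1_pos: "0 < Re z \<Longrightarrow> Gamma (z + 1) = z * Gamma z"
  by (rule Gamma_plus1) (auto elim!: nonpos_Ints_cases)

text \<open>
  The functional equation of the Gamma function, applied once to each factor of the numerator and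
  five times to the denominator. The factor \<open>s + 1\<close> from \<open>\<Gamma>(2 + s)\<close> cancels against the
  factor \<open>5s + 5\<close> from \<open>\<Gamma>(6 + 5s)\<close>, up to the factor \<open>5\<close>, which leaves exactly the indicial polynomial.
\<close>
lemma phi_coeff_recurrence:
  assumes "k \<in> {1..4}"
  shows "indicial (of_nat (Suc n) + rho_k k) * phi_coeff k (Suc n)
       = - ((of_nat (Suc n) + rho_k k) ^ 3 * phi_coeff k n)"
proof -
  define s where "s = of_nat (Suc n) + rho_k k"
  have s: "0 < Re s"
    using assms by (auto simp: s_def rho_k_def)
  have "Gamma (1 + s) = s * Gamma s" "Gamma (2 + s) = (s + 1) * Gamma (1 + s)"
    "Gamma (6 + 5 * s) = (5 * s + 5) * Gamma (5 * s + 5)"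
    "Gamma (5 * s + 5) = (5 * s + 4) * Gamma (5 * s + 4)"
    "Gamma (5 * s + 4) = (5 * s + 3) * Gamma (5 * s + 3)"
    "Gamma (5 * s + 3) = (5 * s + 2) * Gamma (5 * s + 2)"
    "Gamma (5 * s + 2) = (5 * s + 1) * Gamma (5 * s + 1)"
    using Gamma_plus1_pos[of s] Gamma_plus1_pos[of "s + 1"] Gamma_plus1_pos[of "5 * s + 5"]
      Gamma_plus1_pos[of "5 * s + 4"] Gamma_plus1_pos[of "5 * s + 3"]
      Gamma_plus1_pos[of "5 * s + 2"] Gamma_plus1_pos[of "5 * s + 1"] s
    by (simp_all add: add_ac)
  note G = this
  have "Gamma (5 * s + 1) \<noteq> 0"
    using s by (auto simp: Gamma_eq_zero_iff elim!: nonpos_Ints_cases)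
      (auto simp: complex_eq_iff)
  moreover have "5 * s + 1 \<noteq> 0" "5 * s + 2 \<noteq> 0" "5 * s + 3 \<noteq> 0" "5 * s + 4 \<noteq> 0" "s + 1 \<noteq> 0"
    using s by (auto simp: complex_eq_iff)
  \<comment> \<open>The cancellation, with the factors \<open>5s + i\<close> abstracted to \<open>u\<^sub>i\<close> and \<open>s + 1\<close> to \<open>v\<close> so that they are
    not multiplied out.\<close>
  moreover have "5 * u1 * u2 * u3 * u4 * (x * (v * y) / (5 * v * (u4 * (u3 * (u2 * (u1 * B))))) * e)
      = x * y / B * e"
    if "B \<noteq> 0" "u1 \<noteq> 0" "u2 \<noteq> 0" "u3 \<noteq> 0" "u4 \<noteq> 0" "v \<noteq> 0"
    for u1 u2 u3 u4 v x y B e :: complex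
    using that by simp
  note this[of "Gamma (5 * s + 1)" "5 * s + 1" "5 * s + 2" "5 * s + 3" "5 * s + 4" "s + 1"]
  moreover have "5 * s + 5 = 5 * (s + 1)"
    by simp
  ultimately have *: "indicial s * (x * ((s + 1) * y) / Gamma (6 + 5 * s) * e)
      = x * y / Gamma (5 * s + 1) * e" for x y e
    unfolding G indicial_def by metis
  have "phi_coeff k (Suc n)
      = - (Gamma (1 + s) ^ 3 * Gamma (2 + s) / Gamma (6 + 5 * s) * (- 1) ^ n)"
    by (simp add: phi_coeff_def s_def add_ac)
  moreover have "phi_coeff k n = Gamma s ^ 3 * Gamma (1 + s) / Gamma (5 * s + 1) * (- 1) ^ n"
    by (simp add: phi_coeff_def s_def algebra_simps)
  ultimately show ?thesis
    unfolding s_def[symmetric] using *[of "Gamma (1 + s) ^ 3" "Gamma (1 + s)" "(- 1) ^ n"]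
    by (simp add: G(1,2) power_mult_distrib)
qed

text \<open>
  The recurrence multiplies by a cubic in \<open>s\<close> and divides by a quartic, so the quotients of
  successive coefficients are \<open>O(1/n)\<close>.
\<close>
lemma phi_coeff_entire:
  assumes k: "k \<in> {1..4}"
  shows "entire_coeffs (phi_coeff k)"
  unfolding entire_coeffs_def
proof
  fix z :: complex
  have step: "norm (phi_coeff k (Suc n)) * real n \<le> norm (phi_coeff k n)" for n
  proof -
    define r where "r = real (Suc n) - real k / 5"
    have r: "r > 0" "real n \<le> r"
      using k by (auto simp: r_def)
    have s: "of_nat (Suc n) + rho_k k = of_real r"
      by (simp add: r_def rho_k_def)
    have "r ^ 4 \<le> 5 * (5 * r + 1) * (5 * r + 2) * (5 * r + 3) * (5 * r + 4)"
    proof -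
      have "r * r * r * r \<le> (5 * (5 * r + 1)) * (5 * r + 2) * (5 * r + 3) * (5 * r + 4)"
        using r by (intro mult_mono) auto
      then show ?thesis by (simp add: eval_nat_numeral mult_ac)
    qed
    moreover have "norm (indicial (of_real r)) = 5 * (5 * r + 1) * (5 * r + 2) * (5 * r + 3) * (5 * r + 4)"
    proof -
      have "indicial (of_real r) = of_real (5 * (5 * r + 1) * (5 * r + 2) * (5 * r + 3) * (5 * r + 4))"
        by (simp add: indicial_def)
      then show ?thesis using r by (simp only: norm_of_real) simp
    qed
    ultimately have "r ^ 4 * norm (phi_coeff k (Suc n)) \<le> norm (indicial (of_real r) * phi_coeff k (Suc n))"
      by (simp add: norm_mult mult_right_mono)
    also have "\<dots> = r ^ 3 * norm (phi_coeff k n)"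
      using phi_coeff_recurrence[OF k, of n] r unfolding s by (simp add: norm_mult norm_power)
    finally have "r * norm (phi_coeff k (Suc n)) \<le> norm (phi_coeff k n)"
      using r by (simp add: eval_nat_numeral mult.assoc)
    moreover have "norm (phi_coeff k (Suc n)) * real n \<le> r * norm (phi_coeff k (Suc n))"
      using r by (simp add: mult.commute mult_right_mono)
    ultimately show ?thesis by linarith
  qed
  obtain N :: nat where N: "2 * norm z < real N"
    using reals_Archimedean2 by blast
  show "summable (\<lambda>n. phi_coeff k n * z ^ n)"
  proof (rule summable_ratio_test[of "1 / 2" N])
    fix n assume "N \<le> n"
    then have "2 * norm z \<le> real n" using N by linarith
    then have "norm (phi_coeff k (Suc n)) * (2 * norm z) \<le> norm (phi_coeff k n)"
      using step[of n] by (meson mult_left_mono norm_ge_zero order_trans)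
    then have "norm (phi_coeff k (Suc n)) * (2 * norm z) * norm z ^ n \<le> norm (phi_coeff k n) * norm z ^ n"
      by (rule mult_right_mono) simp
    then show "norm (phi_coeff k (Suc n) * z ^ Suc n) \<le> 1 / 2 * norm (phi_coeff k n * z ^ n)"
      by (simp add: norm_mult norm_power mult_ac)
  qed simp
qed

lemma hol_solution_phi:
  assumes "k \<in> {1..4}" shows "hol_solution (phi k)"
  unfolding phi_eq
proof (rule hol_solution_pow_series)
  show "indicial (rho_k k) = 0"
    using assms by (auto simp: indicial_def rho_k_def atLeastAtMost_iff eval_nat_numeral le_Suc_eq)
qed (use assms phi_coeff_entire phi_coeff_recurrence in auto)

lemma hol_solution_w_inf: "hol_solution (w_inf m)"
  unfolding w_inf_def
  by (intro hol_solution_mult hol_solution_sum hol_solution_phi) auto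

lemma hol_solution_f_row: "hol_solution (\<lambda>t. f_row a c t $ k)"
  by (simp add: f_row_def vector_matrix_mult_def sum_4 mult.commute[of "w_inf _ _"])
    (intro hol_solution_mult hol_solution_add hol_solution_w_inf)

section \<open>Rotation of the holomorphic solutions\<close>

lemma zpow_rot: "zpow (rot 2 t) s = exp (- (2 * of_real pi * \<i> * s)) * zpow t s"
  by (simp add: zpow_def rot_def algebra_simps flip: exp_add)

lemma alpha_pow_add: "alpha_pow (s + t) = alpha_pow s * alpha_pow t"
  by (simp add: alpha_pow_def ring_distribs add_divide_distrib exp_add)

lemma alpha_pow_of_nat: "alpha_pow (of_nat n) = alpha_pow 1 ^ n"
  by (simp add: alpha_pow_def mult_ac flip: exp_of_nat_mult)

lemma alpha_pow_5: "alpha_pow 1 ^ 5 = 1"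
  using exp_two_pi_i by (simp add: alpha_pow_def mult_ac flip: exp_of_nat_mult)

lemma alpha_pow_neq_1:
  assumes "k \<in> {1..4}" shows "alpha_pow 1 ^ k \<noteq> 1"
proof
  assume "alpha_pow 1 ^ k = 1"
  then have "exp (of_nat k * (2 * of_real pi * \<i> / 5)) = 1"
    by (simp add: alpha_pow_def flip: exp_of_nat_mult)
  then obtain n :: int where "real k * (2 * pi) / 5 = of_int (2 * n) * pi"
    by (auto simp: exp_eq_1)
  then have "real k = 5 * of_int n"
    by (simp add: field_simps)
  then have "int k = 5 * n"
    by linarith
  then show False
    using assms by auto presburger
qed


text \<open>
  The exponents of \<open>\<phi>\<^sub>5\<^sub>-\<^sub>k\<close> are congruent to \<open>k/5\<close> modulo the integers, so a full turn multiplies it by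
  \<open>\<alpha>\<^sup>-\<^sup>k\<close>. This is written as \<open>\<alpha>\<^sup>4\<^sup>k\<close> because the index \<open>m\<close> of \<open>w\<^sub>m\<close>, which enters through
  \<open>\<alpha>\<^sup>k\<^sup>m\<close>, is a natural number.
\<close>
lemma phi_rot:
  assumes "k \<in> {1..4}"
  shows "phi (5 - k) (rot 2 t) = alpha_pow (of_nat (4 * k)) * phi (5 - k) t"
proof -
  have *: "exp (- (2 * of_real pi * \<i> * (of_nat n + rho_k (5 - k)))) = alpha_pow (of_nat (4 * k))"
    for n
  proof -
    have "- (2 * of_real pi * \<i> * (of_nat n + rho_k (5 - k)))
        = 2 * of_real pi * \<i> * of_nat (4 * k) / 5
          + 2 * of_int (1 - int n - int k) * of_real pi * \<i>"
      using assms by (simp add: rho_k_def of_nat_diff field_simps)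
    moreover have "exp (2 * of_int (1 - int n - int k) * of_real pi * \<i>) = 1"
      using exp_integer_2pi[of "of_int (1 - int n - int k)"] by (simp add: mult_ac)
    ultimately show ?thesis
      by (simp only: exp_add alpha_pow_def mult_1_right)
  qed
  have "summable (\<lambda>n. phi_coeff (5 - k) n * zpow t (of_nat n + rho_k (5 - k)))"
    using assms by (intro summable_pow_series phi_coeff_entire) auto
  then show ?thesis
    unfolding phi_eq pow_series_def zpow_rot *
    by (subst suminf_mult[symmetric]) (simp_all add: mult_ac)
qed

text \<open>A full turn lowers the index by one, and \<open>m - 1\<close> is congruent to \<open>m + 4\<close> modulo five.\<close>
lemma w_inf_rot: "w_inf m (rot 2 t) = w_inf (m + 4) t"
proof -
  have "x * alpha_pow (of_nat (k * m) + y) * phi (5 - k) (rot 2 t)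
      = x * alpha_pow (of_nat (k * (m + 4)) + y) * phi (5 - k) t" if "k \<in> {1..4}" for k x y
  proof -
    have "of_nat (k * (m + 4)) + y = (of_nat (k * m) + y) + of_nat (4 * k)"
      by (simp add: algebra_simps)
    then show ?thesis
      by (simp only: alpha_pow_add phi_rot[OF that, of t] mult_ac)
  qed
  then show ?thesis
    unfolding w_inf_def by (intro arg_cong[where f = "(*) _"] sum.cong refl)
qed

lemma w_inf_add_5: "w_inf (m + 5) = w_inf m"
proof -
  have "alpha_pow (of_nat (k * (m + 5)) + x) = alpha_pow (of_nat (k * m) + x)" for k x
  proof -
    have "alpha_pow (of_nat (k * 5)) = (alpha_pow 1 ^ 5) ^ k"
      by (simp only: alpha_pow_of_nat power_mult[symmetric] mult.commute)
    then have "alpha_pow (of_nat (k * 5)) = 1"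
      by (simp add: alpha_pow_5)
    then show ?thesis
      by (simp add: ring_distribs alpha_pow_add)
  qed
  then show ?thesis
    by (simp add: w_inf_def fun_eq_iff)
qed

text \<open>
  Only the characters \<open>m \<mapsto> \<alpha>\<^sup>k\<^sup>m\<close> with \<open>k \<noteq> 0\<close> modulo five occur in \<open>w\<^sub>m\<close>, and each of them sums to
  zero over a period.
\<close>
lemma sum_w_inf: "(\<Sum>m<5. w_inf m t) = 0"
proof -
  have "(\<Sum>m<5. alpha_pow (of_nat (k * m))) = 0" if "k \<in> {1..4}" for k
  proof -
    define x where "x = alpha_pow 1 ^ k"
    have "x \<noteq> 1"
      unfolding x_def using that by (rule alpha_pow_neq_1)
    moreover have "x ^ 5 = 1"
      unfolding x_def by (metis alpha_pow_5 power_mult mult.commute power_one)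
    moreover have "alpha_pow (of_nat (k * m)) = x ^ m" for m
      by (simp only: alpha_pow_of_nat x_def power_mult)
    ultimately show ?thesis
      by (simp add: sum_gp_strict)
  qed
  note * = this
  have "(\<Sum>m<5. w_inf m t) = (1 - alpha_pow 1) *
     (\<Sum>k=1..4. \<Sum>m<5. alpha_pow (of_nat (k * m)) * ((1 - alpha_pow (of_nat k)) ^ 3
                 * alpha_pow ((of_nat k - 1) / 2) * phi (5 - k) t))"
    unfolding w_inf_def sum_distrib_left[symmetric]
    by (subst sum.swap) (simp add: alpha_pow_add mult_ac)
  also have "\<dots> = 0"
    by (simp add: * sum_distrib_right[symmetric] del: of_nat_mult)
  finally show ?thesis .
qed

lemma f_row_nth:
  "f_row a c t $ k = c * w_inf 0 t * N_mat a $ 1 $ k + c * w_inf 1 t * N_mat a $ 2 $ k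
     + c * w_inf 2 t * N_mat a $ 3 $ k + c * w_inf 4 t * N_mat a $ 4 $ k"
  by (simp add: f_row_def vector_matrix_mult_def sum_4 algebra_simps)

text \<open>
  The turn takes \<open>w\<^sub>0, w\<^sub>1, w\<^sub>2, w\<^sub>4\<close> to \<open>w\<^sub>4, w\<^sub>0, w\<^sub>1, w\<^sub>3\<close>, and \<open>w\<^sub>3\<close> is eliminated by the vanishing sum.
\<close>
lemma f_row_rot_nth:
  "f_row a c (rot 2 t) $ k = c * w_inf 4 t * N_mat a $ 1 $ k + c * w_inf 0 t * N_mat a $ 2 $ k
     + c * w_inf 1 t * N_mat a $ 3 $ k
     - (c * w_inf 0 t + c * w_inf 1 t + c * w_inf 2 t + c * w_inf 4 t) * N_mat a $ 4 $ k"
proof -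
  have "w_inf 0 (rot 2 t) = w_inf 4 t" "w_inf 1 (rot 2 t) = w_inf 0 t"
    "w_inf 2 (rot 2 t) = w_inf 1 t" "w_inf 4 (rot 2 t) = w_inf 3 t"
    using w_inf_rot[of 0 t] w_inf_rot[of 1 t] w_inf_rot[of 2 t] w_inf_rot[of 4 t]
      w_inf_add_5[of 0] w_inf_add_5[of 1] w_inf_add_5[of 3] by simp_all
  moreover have "w_inf 3 t = - (w_inf 0 t + w_inf 1 t + w_inf 2 t + w_inf 4 t)"
    using sum_w_inf[of t] by (simp add: eval_nat_numeral algebra_simps eq_neg_iff_add_eq_0)
  ultimately show ?thesis
    unfolding f_row_nth
    by (simp only: mult_minus_left mult_minus_right add_uminus_conv_diff ring_distribs)
qed

text \<open>The row \<open>\<Phi>\<^bsub>l+\<pi>\<^esub>\<close>, from which the rows of odd index arise by full turns.\<close>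
definition half_rotated_row :: "complex \<Rightarrow> complex \<Rightarrow> cover \<Rightarrow> complex ^ 4" where
  "half_rotated_row a c t = vector
     [f_row a c t $ 1, f_row a c t $ 2, f_row a c t $ 3, f_row a c (rot 2 t) $ 4]"

text \<open>
  Only the last column carries information: \<open>f\<^sub>4\<close> is a multiple of \<open>w\<^sub>0 - w\<^sub>1\<close>, so \<open>f\<^sub>4(z\<^sub>2)\<close> is the same
  multiple of \<open>w\<^sub>4 - w\<^sub>0\<close>, and the column of \<open>K\<close> expresses it through
  \<open>f\<^sub>1, f\<^sub>2, f\<^sub>3, f\<^sub>4\<close>.
\<close>
lemma half_rotated_row_eq: "half_rotated_row a c t = f_row a c t v* K_Rbar a"
proof -
  define w where "w m = c * w_inf m t" for m
  show ?thesis
    by (simp add: half_rotated_row_def mat4_simps K_Rbar_def f_row_rot_nth)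
      (simp add: f_row_nth N_mat_def field_simps flip: w_def)
qed

lemma L_mat_K_R: "L_mat a ** K_R = vector
     [vector [1, 1, 5 / 2 + a, 0],
      vector [0, 1, 5, 0],
      vector [0, 0, 1, 0],
      vector [1, 0, 0, 1]]"
  by (simp add: mat4_simps K_R_def L_mat_def)

text \<open>
  The rotated row \<open>f(z\<^sub>2)\<close> is that of formal monodromy, corrected in its first entry by \<open>f\<^sub>4(z\<^sub>2)\<close>:
  \<open>f\<^sub>1\<close> is a multiple of \<open>w\<^sub>0\<close>, which is taken to \<open>w\<^sub>4 = w\<^sub>0 + (w\<^sub>4 - w\<^sub>0)\<close>.
\<close>
lemma f_row_rot_eq: "f_row a c (rot 2 t) = half_rotated_row a c t v* (L_mat a ** K_R)"
proof -
  define w where "w m = c * w_inf m t" for m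
  show ?thesis
    by (simp only: vec_eq_iff forall_4 vector_matrix_mult_def sum_4 vec_lambda_beta vector_4
          half_rotated_row_def L_mat_K_R f_row_rot_nth)
      (simp only: f_row_nth w_def[symmetric] N_mat_def vector_4, intro conjI,
        simp_all add: field_simps)
qed

lemma Phi_even: "Phi a c (2 * j) t = f_row a c (rot (2 * j) t) v* L_pow a (of_int (- j))"
  by (simp add: Phi_def mat_powi_L_mat)

lemma Phi_odd:
  "Phi a c (2 * j + 1) t = half_rotated_row a c (rot (2 * j) t) v* L_pow a (of_int (- j))"
  by (simp add: Phi_def half_rotated_row_def mat_powi_L_mat)

lemma Phi_odd_eq:
  "Phi a c (2 * k + 1) t = Phi a c (2 * k) t v*
     (mat_powi (L_mat a) k ** K_Rbar a ** mat_powi (L_mat a) (- k))"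
  unfolding Phi_even Phi_odd mat_powi_L_mat half_rotated_row_eq
  by (simp add: vector_matrix_mul_assoc matrix_mul_assoc L_pow_add L_pow_0)

lemma Phi_even_eq:
  "Phi a c (2 * k + 2) t = Phi a c (2 * k + 1) t v*
     (mat_powi (L_mat a) (k + 1) ** K_R ** mat_powi (L_mat a) (- k - 1))"
proof -
  have "Phi a c (2 * k + 2) t = f_row a c (rot 2 (rot (2 * k) t)) v* L_pow a (of_int (- k - 1))"
  proof -
    have "2 * k + 2 = 2 * (k + 1)" "2 + 2 * k = 2 * (k + 1)" "- k - 1 = - (k + 1)"
      by simp_all
    then show ?thesis
      by (simp only: rot_rot Phi_even)
  qed
  then show ?thesis
    unfolding Phi_odd mat_powi_L_mat f_row_rot_eq unfolding L_mat_eq_L_pow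
    by (simp add: vector_matrix_mul_assoc matrix_mul_assoc L_pow_add)
qed

section \<open>Operations on asymptotic expansions\<close>

lemma poincare_asymp_subset:
  "poincare_asymp S f g \<Longrightarrow> T \<subseteq> S \<Longrightarrow> poincare_asymp T f g"
  unfolding poincare_asymp_def by (meson order_trans)

lemma poincare_asymp_linear:
  assumes "poincare_asymp S f (Formal \<kappa> r T)" "poincare_asymp S g (Formal \<kappa> r U)"
  shows "poincare_asymp S (\<lambda>t. x * f t + y * g t) (Formal \<kappa> r (\<lambda>n t. x * T n t + y * U n t))"
  unfolding poincare_asymp_def formal_series.sel
proof (intro allI impI)
  fix lo hi n
  assume S: "lo \<le> hi \<and> {t. lo \<le> Im t \<and> Im t \<le> hi} \<subseteq> S"
  have eq: "zpow t (of_nat (r + n)) * (exp (- \<kappa> * exp t) * (x * f t + y * g t)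
        - (\<Sum>j\<le>n. x * T j t + y * U j t))
      = x * (zpow t (of_nat (r + n)) * (exp (- \<kappa> * exp t) * f t - (\<Sum>j\<le>n. T j t)))
      + y * (zpow t (of_nat (r + n)) * (exp (- \<kappa> * exp t) * g t - (\<Sum>j\<le>n. U j t)))" for t
    by (simp add: sum.distrib sum_distrib_left[symmetric] algebra_simps)
  show "((\<lambda>t. zpow t (of_nat (r + n)) * (exp (- \<kappa> * exp t) * (x * f t + y * g t)
        - (\<Sum>j\<le>n. x * T j t + y * U j t))) \<longlongrightarrow> 0) (at_inf_arg lo hi)"
    unfolding eq using assms S unfolding poincare_asymp_def formal_series.sel
    by (intro tendsto_add_zero tendsto_mult_right_zero) blast+
qed

lemma filterlim_rot_at_inf_arg:
  "filterlim (rot (2 * j)) (at_inf_arg (lo - of_int (2 * j) * pi) (hi - of_int (2 * j) * pi))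
     (at_inf_arg lo hi)"
proof -
  have "filterlim (\<lambda>t. norm (exp t)) at_top (at_inf_arg lo hi)"
    unfolding at_inf_arg_def by (rule filterlim_mono[OF filterlim_filtercomap order_refl inf_le1])
  moreover have "eventually (\<lambda>t. lo \<le> Im t \<and> Im t \<le> hi) (at_inf_arg lo hi)"
    unfolding at_inf_arg_def eventually_inf_principal by simp
  then have "eventually (\<lambda>t. lo - of_int (2 * j) * pi \<le> Im (rot (2 * j) t) \<and>
      Im (rot (2 * j) t) \<le> hi - of_int (2 * j) * pi) (at_inf_arg lo hi)"
    by eventually_elim (simp add: rot_def)
  ultimately show ?thesis
    unfolding at_inf_arg_def[of "lo - _"]
    by (simp add: filterlim_inf filterlim_filtercomap_iff filterlim_principal o_def exp_even_rot
        del: norm_exp_eq_Re)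
qed

lemma zpow_of_nat_rot: "zpow (rot (2 * j) t) (of_nat n) = zpow t (of_nat n)"
  by (simp add: zpow_def exp_of_nat_mult exp_even_rot)

text \<open>
  The gauge \<open>z\<^bsup>r+n\<^esup>\<close> and the exponential factor are functions of \<open>z\<close> and not of \<open>log z\<close>, so a rotation by
  full turns moves nothing but the function, the terms of the series and the sector.
\<close>
lemma poincare_asymp_rot:
  assumes "poincare_asymp (Xi \<alpha> \<beta>) f (Formal \<kappa> r T)"
  shows "poincare_asymp (Xi (\<alpha> + of_int (2 * j) * pi) (\<beta> + of_int (2 * j) * pi))
           (\<lambda>t. f (rot (2 * j) t)) (Formal \<kappa> r (\<lambda>n t. T n (rot (2 * j) t)))"
  unfolding poincare_asymp_def formal_series.sel
proof (intro allI impI)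
  fix lo hi n
  define d where "d = of_int (2 * j) * pi"
  assume S: "lo \<le> hi \<and> {t. lo \<le> Im t \<and> Im t \<le> hi} \<subseteq>
    Xi (\<alpha> + of_int (2 * j) * pi) (\<beta> + of_int (2 * j) * pi)"
  have "lo - d \<le> hi - d \<and> {t. lo - d \<le> Im t \<and> Im t \<le> hi - d} \<subseteq> Xi \<alpha> \<beta>"
  proof (intro conjI subsetI)
    fix t
    assume "t \<in> {t. lo - d \<le> Im t \<and> Im t \<le> hi - d}"
    \<comment> \<open>The point on the strip for \<open>lo\<close> and \<open>hi\<close> that is rotated to \<open>t\<close>.\<close>
    then have "t + Complex 0 d \<in> Xi (\<alpha> + d) (\<beta> + d)"
      unfolding d_def by (intro subsetD[OF conjunct2[OF S]]) auto
    then show "t \<in> Xi \<alpha> \<beta>"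
      by (simp add: Xi_def)
  qed (use S in simp)
  with assms have "((\<lambda>t. zpow t (of_nat (r + n)) * (exp (- \<kappa> * exp t) * f t
      - (\<Sum>j\<le>n. T j t))) \<longlongrightarrow> 0) (at_inf_arg (lo - d) (hi - d))"
    unfolding poincare_asymp_def formal_series.sel by blast
  from filterlim_compose[OF this[unfolded d_def] filterlim_rot_at_inf_arg]
  show "((\<lambda>t. zpow t (of_nat (r + n)) * (exp (- \<kappa> * exp t) * f (rot (2 * j) t)
      - (\<Sum>i\<le>n. T i (rot (2 * j) t)))) \<longlongrightarrow> 0) (at_inf_arg lo hi)"
    by (simp add: zpow_of_nat_rot exp_even_rot del: of_nat_add)
qed

section \<open>Rotation of the formal solutions\<close>

lemma G_term_rot:
  "G_term n (rot (2 * j) t) \<rho> = exp (2 * of_real pi * \<i> * of_int j * \<rho>) * G_term n t \<rho>"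
proof -
  have "- (of_nat n + \<rho> + 1) * rot (2 * j) t
      = 2 * of_real pi * \<i> * of_int j * \<rho> + - (of_nat n + \<rho> + 1) * t
        + 2 * of_int (j * (int n + 1)) * of_real pi * \<i>"
    by (simp add: rot_def algebra_simps)
  moreover have "exp (2 * of_int (j * (int n + 1)) * of_real pi * \<i>) = 1"
    using exp_integer_2pi[of "of_int (j * (int n + 1))"] by simp
  ultimately show ?thesis
    by (simp only: G_term_def zpow_def exp_add mult_1_right mult_1_left mult_ac)
qed

text \<open>
  Conjugation by \<open>e\<^bsup>2\<pi>ij\<rho>\<^esup>\<close> turns \<open>\<partial>\<^sub>\<rho> / 2\<pi>i\<close> into \<open>\<partial>\<^sub>\<rho> / 2\<pi>i + j\<close>; with this normalization the
  formal monodromy has no factors \<open>2\<pi>i\<close>.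
\<close>
lemma d_rho_twist:
  assumes "h holomorphic_on S" "open S" "\<rho> \<in> S"
  shows "d_rho (\<lambda>\<rho>. exp (2 * of_real pi * \<i> * of_int j * \<rho>) * h \<rho>) \<rho>
       = exp (2 * of_real pi * \<i> * of_int j * \<rho>) * (of_int j * h \<rho> + d_rho h \<rho>)"
proof -
  have "(h has_field_derivative deriv h \<rho>) (at \<rho>)"
    using assms by (rule holomorphic_derivI)
  then have "((\<lambda>\<rho>. exp (2 * of_real pi * \<i> * of_int j * \<rho>) * h \<rho>) has_field_derivative
      exp (2 * of_real pi * \<i> * of_int j * \<rho>) * (2 * of_real pi * \<i> * of_int j * h \<rho> + deriv h \<rho>)) (at \<rho>)"
    by (auto intro!: derivative_eq_intros simp: algebra_simps)
  then show ?thesis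
    by (simp add: d_rho_def DERIV_imp_deriv field_simps)
qed

lemma d_rho_d_rho_twist:
  assumes h: "h holomorphic_on S" and S: "open S" "\<rho> \<in> S"
  shows "d_rho (d_rho (\<lambda>\<rho>. exp (2 * of_real pi * \<i> * of_int j * \<rho>) * h \<rho>)) \<rho>
       = exp (2 * of_real pi * \<i> * of_int j * \<rho>)
         * ((of_int j)\<^sup>2 * h \<rho> + 2 * of_int j * d_rho h \<rho> + d_rho (d_rho h) \<rho>)"
proof -
  let ?E = "\<lambda>\<rho>. exp (2 * of_real pi * \<i> * of_int j * \<rho>)"
  have dh: "d_rho h holomorphic_on S"
    unfolding d_rho_def[abs_def] using h S by (intro holomorphic_intros) auto
  have "eventually (\<lambda>x. d_rho (\<lambda>\<rho>. ?E \<rho> * h \<rho>) x = ?E x * (of_int j * h x + d_rho h x)) (nhds \<rho>)"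
    using eventually_nhds_in_open[OF S] by eventually_elim (rule d_rho_twist[OF h S(1)])
  then have "d_rho (d_rho (\<lambda>\<rho>. ?E \<rho> * h \<rho>)) \<rho>
      = d_rho (\<lambda>x. ?E x * (of_int j * h x + d_rho h x)) \<rho>"
    unfolding d_rho_def[of "d_rho _"] d_rho_def[of "\<lambda>x. ?E x * (of_int j * h x + d_rho h x)"]
    by (simp add: deriv_cong_ev)
  also have "\<dots> = ?E \<rho> * (of_int j * (of_int j * h \<rho> + d_rho h \<rho>)
      + d_rho (\<lambda>x. of_int j * h x + d_rho h x) \<rho>)"
    using h dh S by (intro d_rho_twist[of _ S] holomorphic_intros)
  also have "d_rho (\<lambda>x. of_int j * h x + d_rho h x) \<rho> = of_int j * d_rho h \<rho> + d_rho (d_rho h) \<rho>"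
  proof -
    have "h field_differentiable at \<rho>" "d_rho h field_differentiable at \<rho>"
      using h dh S by (auto intro: holomorphic_on_imp_differentiable_at)
    then show ?thesis
      by (simp add: d_rho_def[of "\<lambda>x. of_int j * h x + d_rho h x"] d_rho_def[of h \<rho>]
          d_rho_def[of "d_rho h"] field_differentiable_mult add_divide_distrib)
  qed
  finally show ?thesis
    by (simp add: algebra_simps power2_eq_square)
qed

text \<open>
  The pole of \<open>\<Gamma>(1 + 5(n + \<rho>))\<close> closest to zero lies at \<open>\<rho> = -n - 1/5\<close>, so the half-plane is free of
  poles for every \<open>n\<close>.
\<close>
lemma G_term_holomorphic: "G_term n t holomorphic_on {\<rho>. - 1 / 5 < Re \<rho>}"
proof -
  have "1 + 5 * (of_nat n + \<rho>) \<notin> \<int>\<^sub>\<le>\<^sub>0" "of_nat n + \<rho> + 1 \<notin> \<int>\<^sub>\<le>\<^sub>0" if "- 1 / 5 < Re \<rho>" for \<rho>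
    using that by (auto elim!: nonpos_Ints_cases simp: complex_eq_iff)
  then show ?thesis
    unfolding G_term_def[abs_def] zpow_def
    by (intro holomorphic_intros) (auto simp: Gamma_eq_zero_iff)
qed

lemma d_rho_G_term_rot:
  "d_rho (G_term n (rot (2 * j) t)) 0 = d_rho (G_term n t) 0 + of_int j * G_term n t 0"
  "d_rho (d_rho (G_term n (rot (2 * j) t))) 0
    = d_rho (d_rho (G_term n t)) 0 + 2 * of_int j * d_rho (G_term n t) 0
      + (of_int j)\<^sup>2 * G_term n t 0"
proof -
  have "G_term n (rot (2 * j) t)
      = (\<lambda>\<rho>. exp (2 * of_real pi * \<i> * of_int j * \<rho>) * G_term n t \<rho>)"
    by (rule ext) (rule G_term_rot)
  note * = this d_rho_twist[OF G_term_holomorphic open_halfspace_Re_gt]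
    d_rho_d_rho_twist[OF G_term_holomorphic open_halfspace_Re_gt]
  show "d_rho (G_term n (rot (2 * j) t)) 0 = d_rho (G_term n t) 0 + of_int j * G_term n t 0"
    unfolding *(1) by (subst *(2)) simp_all
  show "d_rho (d_rho (G_term n (rot (2 * j) t))) 0
    = d_rho (d_rho (G_term n t)) 0 + 2 * of_int j * d_rho (G_term n t) 0
      + (of_int j)\<^sup>2 * G_term n t 0"
    unfolding *(1) by (subst *(3)) simp_all
qed

lemma g1_rot: "series_term g1 n (rot (2 * j) t) = series_term g1 n t"
  by (simp add: g1_def G_term_rot)

lemma g2_rot:
  "series_term g2 n (rot (2 * j) t) = series_term g2 n t + of_int j * series_term g1 n t"
  by (simp add: g2_def g1_def d_rho_G_term_rot)

lemma g3_rot: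
  "series_term (g3 a) n (rot (2 * j) t) = series_term (g3 a) n t + 5 * of_int j * series_term g2 n t
     + (5 / 2 * (of_int j)\<^sup>2 + a * of_int j) * series_term g1 n t"
  unfolding g3_def g2_def g1_def formal_series.sel d_rho_G_term_rot
  by (simp add: algebra_simps)

lemma g4_rot: "series_term g4 n (rot (2 * j) t) = series_term g4 n t"
proof -
  have "zpow (rot (2 * j) t) (- of_nat (2 + n)) = zpow t (- of_nat (2 + n))"
    unfolding zpow_def mult_minus_left exp_minus zpow_of_nat_rot[unfolded zpow_def] ..
  then show ?thesis
    by (simp add: g4_def)
qed

section \<open>Asymptotics on the rotated sectors\<close>

text \<open>
  If \<open>F\<close> has the asymptotics of \<open>\<Psi>(z\<^sub>2\<^sub>j) = \<Psi> L\<^sup>j\<close>, then \<open>F L\<^sup>-\<^sup>j\<close> has those of \<open>\<Psi>\<close>. The entries can be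
  combined because the formal series that \<open>L\<close> mixes, \<open>g\<^sub>1, g\<^sub>2, g\<^sub>3\<close>, have the same exponential
  factor and the same leading order. The hypothesis on the last entry contains no rotation, as \<open>g\<^sub>4\<close> has
  no logarithms.
\<close>
lemma poincare_asymp_L_pow_row:
  fixes F :: "cover \<Rightarrow> complex ^ 4" and j :: int
  assumes F: "\<And>k. k \<in> {1, 2, 3} \<Longrightarrow>
      poincare_asymp S (\<lambda>t. F t $ k) (Formal 0 1 (\<lambda>n t. series_term (Psi a $ k) n (rot (2 * j) t)))"
    and F4: "poincare_asymp S (\<lambda>t. F t $ 4) g4"
  shows "poincare_asymp S (\<lambda>t. (F t v* L_pow a (of_int (- j))) $ k) (Psi a $ k)"
proof -
  have F1: "poincare_asymp S (\<lambda>t. F t $ 1) (Formal 0 1 (series_term g1))"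
    and F2: "poincare_asymp S (\<lambda>t. F t $ 2)
      (Formal 0 1 (\<lambda>n t. series_term g2 n t + of_int j * series_term g1 n t))"
    and F3: "poincare_asymp S (\<lambda>t. F t $ 3)
      (Formal 0 1 (\<lambda>n t. series_term (g3 a) n t + 5 * of_int j * series_term g2 n t
     + (5 / 2 * (of_int j)\<^sup>2 + a * of_int j) * series_term g1 n t))"
    using F[of 1] F[of 2] F[of 3] by (simp_all add: Psi_def g1_rot g2_rot g3_rot)
  have g: "g1 = Formal 0 1 (series_term g1)" "g2 = Formal 0 1 (series_term g2)"
    "g3 a = Formal 0 1 (series_term (g3 a))"
    by (simp_all add: g1_def g2_def g3_def)
  have 1: "poincare_asymp S (\<lambda>t. (F t v* L_pow a (of_int (- j))) $ 1) g1"
    using F1 g(1) by (simp add: vector_matrix_mult_def sum_4 L_pow_def)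
  have 2: "poincare_asymp S (\<lambda>t. (F t v* L_pow a (of_int (- j))) $ 2) g2"
    using poincare_asymp_linear[OF F2 F1, of 1 "- of_int j"] g(2)
    by (simp add: vector_matrix_mult_def sum_4 L_pow_def algebra_simps)
  have 3: "poincare_asymp S (\<lambda>t. (F t v* L_pow a (of_int (- j))) $ 3) (g3 a)"
    using poincare_asymp_linear[OF poincare_asymp_linear[OF F3 F2, of 1 "- 5 * of_int j"] F1,
        of 1 "5 / 2 * (of_int j)\<^sup>2 - a * of_int j"] g(3)
    by (simp add: vector_matrix_mult_def sum_4 L_pow_def algebra_simps power2_eq_square)
  have 4: "poincare_asymp S (\<lambda>t. (F t v* L_pow a (of_int (- j))) $ 4) g4"
    using F4 by (simp add: vector_matrix_mult_def sum_4 L_pow_def)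
  show ?thesis
    using 1 2 3 4 exhaust_4[of k] by (auto simp: Psi_def)
qed

lemma hol_solution_matrix_mult:
  fixes F :: "cover \<Rightarrow> complex ^ 4" and A :: "complex ^ 4 ^ 4"
  assumes "\<And>k. hol_solution (\<lambda>t. F t $ k)"
  shows "hol_solution (\<lambda>t. (F t v* A) $ k)"
proof -
  have "hol_solution (\<lambda>t. \<Sum>i\<in>UNIV. A $ i $ k * F t $ i)"
    by (intro hol_solution_sum hol_solution_mult assms)
  then show ?thesis
    by (simp add: vector_matrix_mult_def mult.commute)
qed

lemma hol_solution_Phi: "hol_solution (\<lambda>t. Phi a c m t $ k)"
proof (cases "even m")
  case True
  then obtain j where "m = 2 * j" by blast
  then show ?thesis
    by (simp only: Phi_even)
      (intro hol_solution_matrix_mult hol_solution_rot[of "\<lambda>t. f_row a c t $ _"] hol_solution_f_row)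
next
  case False
  then obtain j where m: "m = 2 * j + 1" by (blast elim: oddE)
  have "hol_solution (\<lambda>t. half_rotated_row a c (rot (2 * j) t) $ k)" for k
    unfolding half_rotated_row_eq
    by (intro hol_solution_matrix_mult hol_solution_rot[of "\<lambda>t. f_row a c t $ _"] hol_solution_f_row)
  then show ?thesis
    unfolding m Phi_odd by (rule hol_solution_matrix_mult)
qed

theorem proposition2p5:
  fixes a c\<^sub>N :: complex
  assumes "\<And>k::4. k \<in> {1, 2, 3} \<Longrightarrow>
             poincare_asymp (Xi (- (pi / 2)) (5 * pi / 2)) (\<lambda>z. f_row a c\<^sub>N z $ k) (Psi a $ k)"
    and "poincare_asymp (Xi (- (3 * pi / 2)) (3 * pi / 2)) (\<lambda>z. f_row a c\<^sub>N z $ 4) (Psi a $ 4)"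
  shows "(\<forall>m::int. \<forall>k::4. hol_solution (\<lambda>z. Phi a c\<^sub>N m z $ k)) \<and>
    (\<forall>m::int. \<forall>k::4. poincare_asymp (Xi_l m) (\<lambda>z. Phi a c\<^sub>N m z $ k) (Psi a $ k)) \<and>
    (\<forall>k::int. \<forall>z \<in> Xi_l (2 * k + 1) \<inter> Xi_l (2 * k).
       Phi a c\<^sub>N (2 * k + 1) z =
         Phi a c\<^sub>N (2 * k) z v*
           (mat_powi (L_mat a) k ** K_Rbar a ** mat_powi (L_mat a) (- k))) \<and>
    (\<forall>k::int. \<forall>z \<in> Xi_l (2 * k + 2) \<inter> Xi_l (2 * k + 1).
       Phi a c\<^sub>N (2 * k + 2) z =
         Phi a c\<^sub>N (2 * k + 1) z v*
           (mat_powi (L_mat a) (k + 1) ** K_R ** mat_powi (L_mat a) (- k - 1)))"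
proof (intro conjI allI ballI)
  show "hol_solution (\<lambda>z. Phi a c\<^sub>N m z $ k)" for m k
    by (rule hol_solution_Phi)
  show "Phi a c\<^sub>N (2 * k + 1) z = Phi a c\<^sub>N (2 * k) z v*
      (mat_powi (L_mat a) k ** K_Rbar a ** mat_powi (L_mat a) (- k))" for k z
    by (rule Phi_odd_eq)
  show "Phi a c\<^sub>N (2 * k + 2) z = Phi a c\<^sub>N (2 * k + 1) z v*
      (mat_powi (L_mat a) (k + 1) ** K_R ** mat_powi (L_mat a) (- k - 1))" for k z
    by (rule Phi_even_eq)
  have f: "poincare_asymp (Xi (- (pi / 2) + of_int (2 * j) * pi) (5 * pi / 2 + of_int (2 * j) * pi))
      (\<lambda>t. f_row a c\<^sub>N (rot (2 * j) t) $ k)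
      (Formal 0 1 (\<lambda>n t. series_term (Psi a $ k) n (rot (2 * j) t)))" if "k \<in> {1, 2, 3}" for j k
  proof -
    have "Psi a $ k = Formal 0 1 (series_term (Psi a $ k))"
      using that by (auto simp: Psi_def g1_def g2_def g3_def)
    with assms(1)[OF that] show ?thesis
      by (intro poincare_asymp_rot) simp
  qed
  have f4: "poincare_asymp (Xi (- (3 * pi / 2) + of_int (2 * j) * pi) (3 * pi / 2 + of_int (2 * j) * pi))
      (\<lambda>t. f_row a c\<^sub>N (rot (2 * j) t) $ 4) g4" for j
  proof -
    have g: "g4 = Formal (- 1 / 5 ^ 5) 2 (series_term g4)"
      by (simp add: g4_def)
    with assms(2) have "poincare_asymp (Xi (- (3 * pi / 2)) (3 * pi / 2)) (\<lambda>z. f_row a c\<^sub>N z $ 4)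
        (Formal (- 1 / 5 ^ 5) 2 (series_term g4))"
      by (simp add: Psi_def)
    from poincare_asymp_rot[OF this, of j] show ?thesis
      by (subst g) (simp only: g4_rot)
  qed
  show "poincare_asymp (Xi_l m) (\<lambda>z. Phi a c\<^sub>N m z $ k) (Psi a $ k)" for m k
  proof (cases "even m")
    case True
    then obtain j where m: "m = 2 * j" by blast
    show ?thesis
      unfolding m Phi_even
      by (intro poincare_asymp_L_pow_row poincare_asymp_subset[OF f] poincare_asymp_subset[OF f4])
        (auto simp: Xi_l_def Xi_def)
  next
    case False
    then obtain j where m: "m = 2 * j + 1" by (blast elim: oddE)
    have h: "half_rotated_row a c\<^sub>N (rot (2 * j) t) $ k = f_row a c\<^sub>N (rot (2 * j) t) $ k"
      if "k \<in> {1, 2, 3}" for k t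
      using that by (auto simp: half_rotated_row_def)
    \<comment> \<open>The additional turn moves the sector of \<open>f\<^sub>4\<close> far enough to contain the one of index \<open>2j + 1\<close>.\<close>
    have h4: "half_rotated_row a c\<^sub>N (rot (2 * j) t) $ 4 = f_row a c\<^sub>N (rot (2 * (j + 1)) t) $ 4" for t
      by (simp add: half_rotated_row_def rot_rot algebra_simps)
    have "poincare_asymp (Xi_l m) (\<lambda>t. half_rotated_row a c\<^sub>N (rot (2 * j) t) $ k)
      (Formal 0 1 (\<lambda>n t. series_term (Psi a $ k) n (rot (2 * j) t)))" if "k \<in> {1, 2, 3}" for k
      unfolding h[OF that] using that
      by (rule poincare_asymp_subset[OF f]) (auto simp: m Xi_l_def Xi_def algebra_simps)
    moreover have "poincare_asymp (Xi_l m) (\<lambda>t. half_rotated_row a c\<^sub>N (rot (2 * j) t) $ 4) g4"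
      unfolding h4
      by (rule poincare_asymp_subset[OF f4]) (auto simp: m Xi_l_def Xi_def algebra_simps)
    ultimately show ?thesis
      unfolding m Phi_odd by (rule poincare_asymp_L_pow_row)
  qed
qed

end
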